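(* For every finite graph $G$ and every integer $k\ge 0$ there is a tight, nested, and $\mathrm{Aut}(G)$-invariant separation system $\mathcal N_k$ of $G$ that distinguishes every two $k$-distinguishable $k$-robust blocks of $G$ efficiently. In particular, $\mathcal N_k$ distinguishes every two distinct $k$-blocks of $G$ efficiently.
   Context: Separations. A separation of $G=(V,E)$ is an ordered pair $(A,B)$ with $A,B\subseteq V$ and $G[A]\cup G[B]=G$. It is proper if $A\setminus B\ne\emptyset\ne B\setminus A$; its order is $|A\cap B|$; a $k$-separation is a separation of order $k$. It is tight if every vertex of $A\cap B$ has a neighbour in $A\setminus B$ and a neighbour in $B\setminus A$. Write $(A,B)\le(C,D)$ if $A\subseteq C$ and $B\supseteq D$. Two separations $(A,B),(C,D)$ are nested if $(A,B)$ is $\le$-comparable with $(C,D)$ or $(D,C)$; otherwise they cross. A separation system is a set of proper separations of $G$ that contains $(B,A)$ whenever it contains $(A,B)$. It is nested if every two of its elements are nested, tight if all its elements are tight, and $\mathrm{Aut}(G)$-invariant if every automorphism of $G$ maps it to itself. For two separations $(A,B),(C,D)$ the boundaries of the corners $A\cap D$ and $B\cap D$ are $\partial(A\cap D)=(A\cap D)\cap(B\cup C)$ and $\partial(B\cap D)=(B\cap D)\cap(A\cup C)$. A separation $(A,B)$ separates two vertex sets $I_0,I_1$ if $I_i\subseteq A$ and $I_{1-i}\subseteq B$ for some $i\in\{0,1\}$ and neither $I_0$ nor $I_1$ is contained in $A\cap B$. Blocks. A set $X\subseteq V$ is $k$-inseparable if $|X|>k$ and no set $S$ of at most $k$ vertices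 separates two vertices of $X\setminus S$ in $G$. A $k$-block ($k\ge0$ an integer) is a maximal $k$-inseparable set. A block is a set that is a $k$-block for some $k$; its rank $r(b)$ is the smallest such $k$. A $k$-inseparable set $U$ is $K$-robust (as a $k$-inseparable set) if for every $k$-separation $(C,D)$ with $U\subseteq D$ and every separation $(A,B)$ of order at most $K$ that crosses $(C,D)$ and satisfies $|\partial(A\cap D)|<k$ and $|\partial(B\cap D)|<k$, we have $U\subseteq A$ or $U\subseteq B$. A block $b$ is $K$-robust if it is $K$-robust as an $r(b)$-inseparable set. Two blocks are distinguishable if neither contains the other. For distinguishable blocks $b_1,b_2$, $\kappa(b_1,b_2)$ denotes the smallest order of a separation of $G$ that separates them (one has $\kappa(b_1,b_2)\le\min\{r(b_1),r(b_2)\}$); they are $k$-distinguishable if $\kappa(b_1,b_2)\le k$. (Distinct $k$-blocks are always $k$-distinguishable.) A set of separations distinguishes two blocks (or $k$-blocks) $b_1,b_2$ efficiently if it contains a separation of order $\kappa(b_1,b_2)$ that separates $b_1$ and $b_2$. *)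

theory Defs
  imports Main
begin

record 'a ugraph =
  verts :: "'a set"
  edges :: "'a set set"

definition finite_graph :: "'a ugraph \<Rightarrow> bool" where
  "finite_graph G \<longleftrightarrow> finite (verts G) \<and> (\<forall>e\<in>edges G. e \<subseteq> verts G \<and> card e = 2)"

definition adj :: "'a ugraph \<Rightarrow> 'a \<Rightarrow> 'a \<Rightarrow> bool" where
  "adj G x y \<longleftrightarrow> {x, y} \<in> edges G"

definition induced :: "'a ugraph \<Rightarrow> 'a set \<Rightarrow> 'a ugraph" where
  "induced G A = \<lparr>verts = A, edges = {e \<in> edges G. e \<subseteq> A}\<rparr>"

definition graph_union :: "'a ugraph \<Rightarrow> 'a ugraph \<Rightarrow> 'a ugraph" where
  "graph_union G H = \<lparr>verts = verts G \<union> verts H, edges = edges G \<union> edges H\<rparr>"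

definition path :: "'a ugraph \<Rightarrow> 'a \<Rightarrow> 'a list \<Rightarrow> 'a \<Rightarrow> bool" where
  "path G x p y \<longleftrightarrow> p \<noteq> [] \<and> distinct p \<and> set p \<subseteq> verts G \<and>
     successively (adj G) p \<and> hd p = x \<and> last p = y"

text \<open>Only the values of \<open>f\<close> on the vertex set matter.\<close>

definition automorphism :: "'a ugraph \<Rightarrow> ('a \<Rightarrow> 'a) \<Rightarrow> bool" where
  "automorphism G f \<longleftrightarrow> bij_betw f (verts G) (verts G) \<and>
     (\<forall>x\<in>verts G. \<forall>y\<in>verts G. adj G (f x) (f y) \<longleftrightarrow> adj G x y)"


type_synonym 'a sep = "'a set \<times> 'a set"

definition separation :: "'a ugraph \<Rightarrow> 'a sep \<Rightarrow> bool" where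
  "separation G = (\<lambda>(A, B). A \<subseteq> verts G \<and> B \<subseteq> verts G \<and>
     graph_union (induced G A) (induced G B) = G)"

definition proper :: "'a sep \<Rightarrow> bool" where
  "proper = (\<lambda>(A, B). A - B \<noteq> {} \<and> B - A \<noteq> {})"

definition sep_order :: "'a sep \<Rightarrow> nat" where
  "sep_order = (\<lambda>(A, B). card (A \<inter> B))"

definition tight :: "'a ugraph \<Rightarrow> 'a sep \<Rightarrow> bool" where
  "tight G = (\<lambda>(A, B). \<forall>v\<in>A \<inter> B. (\<exists>u\<in>A - B. adj G v u) \<and> (\<exists>w\<in>B - A. adj G v w))"

definition sep_le :: "'a sep \<Rightarrow> 'a sep \<Rightarrow> bool" where
  "sep_le = (\<lambda>(A, B) (C, D). A \<subseteq> C \<and> D \<subseteq> B)"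

definition comparable :: "'a sep \<Rightarrow> 'a sep \<Rightarrow> bool" where
  "comparable s t \<longleftrightarrow> sep_le s t \<or> sep_le t s"

definition nested :: "'a sep \<Rightarrow> 'a sep \<Rightarrow> bool" where
  "nested s t \<longleftrightarrow> comparable s t \<or> comparable s (prod.swap t)"

abbreviation crosses :: "'a sep \<Rightarrow> 'a sep \<Rightarrow> bool" where
  "crosses s t \<equiv> \<not> nested s t"

definition separation_system :: "'a ugraph \<Rightarrow> 'a sep set \<Rightarrow> bool" where
  "separation_system G N \<longleftrightarrow>
     (\<forall>s\<in>N. separation G s \<and> proper s) \<and> (\<forall>s\<in>N. prod.swap s \<in> N)"

definition nested_system :: "'a sep set \<Rightarrow> bool" where
  "nested_system N \<longleftrightarrow> (\<forall>s\<in>N. \<forall>t\<in>N. nested s t)"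

definition tight_system :: "'a ugraph \<Rightarrow> 'a sep set \<Rightarrow> bool" where
  "tight_system G N \<longleftrightarrow> (\<forall>s\<in>N. tight G s)"

definition aut_invariant :: "'a ugraph \<Rightarrow> 'a sep set \<Rightarrow> bool" where
  "aut_invariant G N \<longleftrightarrow>
     (\<forall>f. automorphism G f \<longrightarrow> (\<lambda>(A, B). (f ` A, f ` B)) ` N = N)"

definition corner_boundary :: "'a sep \<Rightarrow> 'a sep \<Rightarrow> 'a set" where
  "corner_boundary = (\<lambda>(A, B) (C, D). (A \<inter> D) \<inter> (B \<union> C))"

definition separates :: "'a sep \<Rightarrow> 'a set \<Rightarrow> 'a set \<Rightarrow> bool" where
  "separates = (\<lambda>(A, B) I J. (I \<subseteq> A \<and> J \<subseteq> B \<or> J \<subseteq> A \<and> I \<subseteq> B) \<and>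
     \<not> I \<subseteq> A \<inter> B \<and> \<not> J \<subseteq> A \<inter> B)"


definition separates_vertices :: "'a ugraph \<Rightarrow> 'a set \<Rightarrow> 'a \<Rightarrow> 'a \<Rightarrow> bool" where
  "separates_vertices G S x y \<longleftrightarrow> (\<forall>p. path G x p y \<longrightarrow> set p \<inter> S \<noteq> {})"

definition inseparable :: "'a ugraph \<Rightarrow> nat \<Rightarrow> 'a set \<Rightarrow> bool" where
  "inseparable G k X \<longleftrightarrow> X \<subseteq> verts G \<and> card X > k \<and>
     \<not> (\<exists>S. S \<subseteq> verts G \<and> card S \<le> k \<and>
          (\<exists>x\<in>X - S. \<exists>y\<in>X - S. x \<noteq> y \<and> separates_vertices G S x y))"

definition kblock :: "'a ugraph \<Rightarrow> nat \<Rightarrow> 'a set \<Rightarrow> bool" where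
  "kblock G k X \<longleftrightarrow> inseparable G k X \<and> (\<forall>Y. inseparable G k Y \<and> X \<subseteq> Y \<longrightarrow> Y = X)"

definition block :: "'a ugraph \<Rightarrow> 'a set \<Rightarrow> bool" where
  "block G b \<longleftrightarrow> (\<exists>k. kblock G k b)"

definition rank :: "'a ugraph \<Rightarrow> 'a set \<Rightarrow> nat" where
  "rank G b = (LEAST k. kblock G k b)"

text \<open>
  \<open>K\<close>-robustness of \<open>U\<close> as a \<open>k\<close>-inseparable set. For \<open>s = (A, B)\<close> and
  \<open>t = (C, D)\<close>, the sets \<open>corner_boundary s t\<close> and
  \<open>corner_boundary (prod.swap s) t\<close> are the boundaries of the corners \<open>A \<inter> D\<close>
  and \<open>B \<inter> D\<close>. Here \<open>s\<close> and \<open>t\<close> need not be proper.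
\<close>

definition robust :: "'a ugraph \<Rightarrow> nat \<Rightarrow> nat \<Rightarrow> 'a set \<Rightarrow> bool" where
  "robust G K k U \<longleftrightarrow> inseparable G k U \<and>
     (\<forall>t s. separation G t \<and> sep_order t = k \<and> U \<subseteq> snd t \<and>
        separation G s \<and> sep_order s \<le> K \<and> crosses s t \<and>
        card (corner_boundary s t) < k \<and> card (corner_boundary (prod.swap s) t) < k \<longrightarrow>
        U \<subseteq> fst s \<or> U \<subseteq> snd s)"

definition robust_block :: "'a ugraph \<Rightarrow> nat \<Rightarrow> 'a set \<Rightarrow> bool" where
  "robust_block G K b \<longleftrightarrow> block G b \<and> robust G K (rank G b) b"

definition distinguishable :: "'a set \<Rightarrow> 'a set \<Rightarrow> bool" where
  "distinguishable b1 b2 \<longleftrightarrow> \<not> b1 \<subseteq> b2 \<and> \<not> b2 \<subseteq> b1"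

text \<open>
  The minimum is over a nonempty set of orders whenever \<open>b1\<close> and \<open>b2\<close> are
  distinguishable blocks of a finite graph; \<open>kappa\<close> is used only in that case.
\<close>

definition kappa :: "'a ugraph \<Rightarrow> 'a set \<Rightarrow> 'a set \<Rightarrow> nat" where
  "kappa G b1 b2 =
     (LEAST n. \<exists>s. separation G s \<and> separates s b1 b2 \<and> sep_order s = n)"

definition k_distinguishable :: "'a ugraph \<Rightarrow> nat \<Rightarrow> 'a set \<Rightarrow> 'a set \<Rightarrow> bool" where
  "k_distinguishable G k b1 b2 \<longleftrightarrow> distinguishable b1 b2 \<and> kappa G b1 b2 \<le> k"

definition distinguishes_efficiently ::
    "'a ugraph \<Rightarrow> 'a sep set \<Rightarrow> 'a set \<Rightarrow> 'a set \<Rightarrow> bool" where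
  "distinguishes_efficiently G N b1 b2 \<longleftrightarrow>
     (\<exists>s\<in>N. sep_order s = kappa G b1 b2 \<and> separates s b1 b2)"

end

theory Submission
  imports Defs
begin

text \<open>
  The system is built order by order. For each \<open>l \<le> k\<close> consider the pairs of robust
  \<open>l\<close>-inseparable sets whose cheapest separation has order exactly \<open>l\<close>. Among the order-\<open>l\<close>
  separations of such a pair that are nested with everything chosen at smaller orders, all those
  crossing the fewest separations of \<open>G\<close> are added. Nothing in this choice is arbitrary, so the
  result is invariant under automorphisms. Efficient separations are automatically proper and
  tight: a separator vertex without a neighbour on one side could be deleted from that side,
  giving a cheaper separation of the same pair.

  Nestedness rests on uncrossing. Opposite corners of two crossing separations have total order
  equal to the sum of the two orders (\<open>sep_order_corners\<close>) and strictly smaller total crossing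
  number (\<open>crossing_number_corners\<close>).

  \<^item> If an order-\<open>l\<close> separation crosses one of order \<open>m > l\<close>, the pair belonging to the larger
  order lies on one side of the smaller separation, and one of the two corners on that side is
  again an efficient separation of the pair. Otherwise both corners on the other side would have
  order less than \<open>l\<close>; robustness then confines the set living there to one of them, and that
  corner would separate the first pair too cheaply (\<open>corner_of_lower_order\<close>). Replacing
  separations by such corners reduces the crossings with the earlier stages to none, so every pair
  has a candidate when its stage is reached (\<open>best_candidate_exists\<close>).

  \<^item> If two chosen separations of the same order \<open>l\<close> cross, some opposite corners are efficient
  separations for the respective pairs and nested with all earlier stages, so the strict drop in
  crossing numbers contradicts minimality (\<open>best_candidates_nested\<close>).

  Blocks enter only at the end. A block that is robust at its rank \<open>r\<close> is robust at every smaller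
  order (\<open>robust_antimono\<close>), and \<open>kappa\<close> of two distinguishable blocks is at most both ranks
  (\<open>kappa_blocks\<close>); hence every pair in question is treated at the stage given by its \<open>kappa\<close>.
\<close>


section \<open>Separations and inseparable sets\<close>

lemma separation_iff:
  "separation G (A, B) \<longleftrightarrow> A \<union> B = verts G \<and> (\<forall>e\<in>edges G. e \<subseteq> A \<or> e \<subseteq> B)"
proof -
  have "graph_union (induced G A) (induced G B) = G \<longleftrightarrow>
      A \<union> B = verts G \<and> {e \<in> edges G. e \<subseteq> A} \<union> {e \<in> edges G. e \<subseteq> B} = edges G"
    by (cases G) (simp add: graph_union_def induced_def)
  then show ?thesis
    unfolding separation_def by auto
qed

lemma separation_swap [simp]: "separation G (prod.swap s) \<longleftrightarrow> separation G s"
  by (cases s) (auto simp: separation_iff)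

lemma sep_order_swap [simp]: "sep_order (prod.swap s) = sep_order s"
  by (cases s) (simp add: sep_order_def Int_commute)

lemma separates_swap [simp]: "separates (prod.swap s) I J \<longleftrightarrow> separates s I J"
  by (cases s) (auto simp: separates_def)

lemma separates_commute: "separates s I J \<longleftrightarrow> separates s J I"
  by (cases s) (auto simp: separates_def)

lemma finite_separations:
  assumes "finite_graph G"
  shows "finite {s. separation G s}"
proof -
  have "{s. separation G s} \<subseteq> Pow (verts G) \<times> Pow (verts G)"
    by (auto simp: separation_iff)
  then show ?thesis
    by (rule finite_subset) (use assms in \<open>simp add: finite_graph_def\<close>)
qed

lemma finite_sides:
  assumes "finite_graph G" "separation G (A, B)"
  shows "finite A" "finite B"
  using assms by (auto simp: finite_graph_def separation_iff intro: finite_subset)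

text \<open>
  The next two lemmas translate between separating vertex sets, defined by paths, and separations;
  together they give the description of inseparability used everywhere below.
\<close>

lemma walk_meets_separator:
  assumes "separation G (A, B)" "p \<noteq> []" "successively (adj G) p" "hd p \<in> A" "last p \<in> B"
  shows "set p \<inter> (A \<inter> B) \<noteq> {}"
  using assms(2-)
proof (induction p rule: induct_list012)
  case (3 x y p)
  then have "{x, y} \<subseteq> A \<or> {x, y} \<subseteq> B"
    using assms(1) by (auto simp: separation_iff adj_def)
  then show ?case
    using 3 by auto
qed auto

lemma separation_of_separator:
  assumes G: "finite_graph G" and S: "S \<subseteq> verts G" "x \<in> verts G - S" "y \<in> verts G - S"
    and sv: "separates_vertices G S x y"
  obtains A B where "separation G (A, B)" "A \<inter> B = S" "x \<in> A - B" "y \<in> B - A"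
proof -
  \<comment> \<open>\<open>R\<close> is the vertex set of the component of \<open>x\<close> in \<open>G - S\<close>.\<close>
  define R where "R = {z. \<exists>p. path G x p z \<and> set p \<inter> S = {}}"
  have RV: "R \<subseteq> verts G" "R \<inter> S = {}"
    unfolding R_def path_def by (auto, metis disjoint_iff last_in_set)
  have "path G x [x] x"
    using S by (simp add: path_def)
  then have xR: "x \<in> R"
    unfolding R_def using S by force
  have yR: "y \<notin> R"
    using sv by (auto simp: R_def separates_vertices_def)
  have step: "v \<in> R" if u: "u \<in> R" and e: "{u, v} \<in> edges G" and v: "v \<notin> S" for u v
  proof -
    obtain p where p: "path G x p u" "set p \<inter> S = {}"
      using u by (auto simp: R_def)
    show ?thesis
    proof (cases "v \<in> set p")
      case True
      then obtain p1 p2 where "p = (p1 @ [v]) @ p2"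
        by (metis split_list append.assoc append_Cons append_Nil)
      then have "path G x (p1 @ [v]) v \<and> set (p1 @ [v]) \<inter> S = {}"
        using p by (auto simp: path_def successively_append_iff hd_append split: if_splits)
      then show ?thesis
        unfolding R_def by blast
    next
      case False
      have "v \<in> verts G"
        using G e by (auto simp: finite_graph_def)
      then have "path G x (p @ [v]) v \<and> set (p @ [v]) \<inter> S = {}"
        using p v e False by (auto simp: path_def successively_append_iff adj_def)
      then show ?thesis
        unfolding R_def by blast
    qed
  qed
  have "e \<subseteq> R \<union> S \<or> e \<subseteq> verts G - R" if e: "e \<in> edges G" for e
  proof -
    obtain u v where uv: "e = {u, v}"
      using G e by (auto simp: finite_graph_def card_2_iff)
    have "{v, u} \<in> edges G" "{u, v} \<in> edges G"
      using e uv by (auto simp: insert_commute)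
    then show ?thesis
      using G e uv step[of u v] step[of v u] by (auto simp: finite_graph_def)
  qed
  then have "separation G (R \<union> S, verts G - R)"
    using RV S by (auto simp: separation_iff)
  moreover have "(R \<union> S) \<inter> (verts G - R) = S"
    using RV S by auto
  ultimately show ?thesis
    using that[of "R \<union> S" "verts G - R"] xR yR S RV by auto
qed

lemma inseparable_iff:
  assumes G: "finite_graph G"
  shows "inseparable G k X \<longleftrightarrow> X \<subseteq> verts G \<and> card X > k \<and>
    (\<forall>s. separation G s \<and> sep_order s \<le> k \<longrightarrow> X \<subseteq> fst s \<or> X \<subseteq> snd s)"
proof (intro iffI conjI allI impI)
  fix s assume X: "inseparable G k X" and s: "separation G s \<and> sep_order s \<le> k"
  obtain A B where AB: "s = (A, B)"
    by (cases s)
  have AV: "A \<union> B = verts G"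
    using s AB by (simp add: separation_iff)
  show "X \<subseteq> fst s \<or> X \<subseteq> snd s"
  proof (rule ccontr)
    assume "\<not> (X \<subseteq> fst s \<or> X \<subseteq> snd s)"
    then obtain x y where xy: "x \<in> X" "x \<notin> B" "y \<in> X" "y \<notin> A"
      using AB by auto
    have XV: "X \<subseteq> verts G"
      using X by (simp add: inseparable_def)
    have "separates_vertices G (A \<inter> B) x y"
      unfolding separates_vertices_def
    proof (intro allI impI)
      fix p assume "path G x p y"
      then show "set p \<inter> (A \<inter> B) \<noteq> {}"
        using walk_meets_separator[of G A B p] s AB xy XV AV by (auto simp: path_def)
    qed
    moreover have "x \<in> X - (A \<inter> B)" "y \<in> X - (A \<inter> B)" "x \<noteq> y"
      using xy XV AV by auto
    moreover have "A \<inter> B \<subseteq> verts G" "card (A \<inter> B) \<le> k"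
      using s AB AV by (auto simp: sep_order_def)
    ultimately show False
      using X unfolding inseparable_def by blast
  qed
next
  assume R: "X \<subseteq> verts G \<and> card X > k \<and>
    (\<forall>s. separation G s \<and> sep_order s \<le> k \<longrightarrow> X \<subseteq> fst s \<or> X \<subseteq> snd s)"
  have False if S: "S \<subseteq> verts G" "card S \<le> k" "x \<in> X - S" "y \<in> X - S"
    and sv: "separates_vertices G S x y" for S x y
  proof -
    obtain A B where "separation G (A, B)" "A \<inter> B = S" "x \<in> A - B" "y \<in> B - A"
      using separation_of_separator[OF G S(1) _ _ sv] S R by blast
    then show False
      using R S by (force simp: sep_order_def)
  qed
  then show "inseparable G k X"
    unfolding inseparable_def using R by blast
qed (auto simp: inseparable_def)

lemma inseparable_side:
  assumes "finite_graph G" "inseparable G k X" "separation G (A, B)" "card (A \<inter> B) \<le> k"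
  shows "X \<subseteq> A \<or> X \<subseteq> B"
  using assms(2)[unfolded inseparable_iff[OF assms(1)]] assms(3-) by (force simp: sep_order_def)

text \<open>
  This makes the side chosen by an inseparable set unique.
\<close>

lemma inseparable_not_in_separator:
  assumes "finite_graph G" "inseparable G k X" "separation G (A, B)" "card (A \<inter> B) \<le> k"
  shows "\<not> X \<subseteq> A \<inter> B"
proof
  assume "X \<subseteq> A \<inter> B"
  then have "card X \<le> card (A \<inter> B)"
    using finite_sides[OF assms(1,3)] by (intro card_mono) auto
  then show False
    using assms(2,4) by (simp add: inseparable_def)
qed

lemma inseparable_antimono:
  assumes "finite_graph G" "inseparable G k X" "l \<le> k"
  shows "inseparable G l X"
  using assms by (auto simp: inseparable_iff)


section \<open>Corners of crossing separations\<close>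

definition corner :: "'a sep \<Rightarrow> 'a sep \<Rightarrow> 'a sep" where
  "corner = (\<lambda>(A, B) (C, D). (A \<inter> C, B \<union> D))"

lemma nested_iff: "nested (A, B) (C, D) \<longleftrightarrow>
    A \<subseteq> C \<and> D \<subseteq> B \<or> C \<subseteq> A \<and> B \<subseteq> D \<or> A \<subseteq> D \<and> C \<subseteq> B \<or> D \<subseteq> A \<and> B \<subseteq> C"
  by (auto simp: nested_def comparable_def sep_le_def)

lemma nested_commute: "nested s t \<longleftrightarrow> nested t s"
  by (cases s; cases t) (auto simp: nested_iff)

lemma nested_refl [simp]: "nested s s"
  by (cases s) (simp add: nested_iff)

lemma nested_swap1 [simp]: "nested (prod.swap s) t \<longleftrightarrow> nested s t"
  by (cases s; cases t) (auto simp: nested_iff)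

lemma nested_swap2 [simp]: "nested t (prod.swap s) \<longleftrightarrow> nested t s"
  by (cases s; cases t) (auto simp: nested_iff)

lemma corner_commute: "corner s t = corner t s"
  by (cases s; cases t) (auto simp: corner_def)

lemma separation_corner:
  assumes "separation G s" "separation G t"
  shows "separation G (corner s t)"
proof -
  obtain A B C D where st: "s = (A, B)" "t = (C, D)"
    by (cases s; cases t)
  have V: "A \<union> B = verts G" "C \<union> D = verts G"
    using assms by (auto simp: st separation_iff)
  have "e \<subseteq> A \<inter> C \<or> e \<subseteq> B \<union> D" if "e \<in> edges G" for e
  proof -
    have "e \<subseteq> A \<or> e \<subseteq> B" "e \<subseteq> C \<or> e \<subseteq> D"
      using assms that by (auto simp: st separation_iff)
    then show ?thesis
      by blast
  qed
  then show ?thesis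
    using V by (auto simp: st corner_def separation_iff)
qed

text \<open>
  The separators of the two opposite corners have the same union and the same intersection as
  those of \<open>s\<close> and \<open>t\<close>, hence equality instead of mere submodularity.
\<close>

lemma sep_order_corners:
  assumes G: "finite_graph G" and s: "separation G s" and t: "separation G t"
  shows "sep_order (corner s t) + sep_order (corner (prod.swap s) (prod.swap t)) =
    sep_order s + sep_order t"
proof -
  obtain A B C D where st: "s = (A, B)" "t = (C, D)"
    by (cases s; cases t)
  let ?X = "A \<inter> C \<inter> (B \<union> D)" and ?Y = "B \<inter> D \<inter> (A \<union> C)"
  have V: "A \<union> B = verts G" "C \<union> D = verts G"
    using s t by (auto simp: st separation_iff)
  have fin: "finite A" "finite B" "finite C" "finite D"
    using finite_sides[OF G] s t by (auto simp: st)
  have "card ?X + card ?Y = card (?X \<union> ?Y) + card (?X \<inter> ?Y)"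
    by (rule card_Un_Int) (use fin in auto)
  also have "?X \<union> ?Y = (A \<inter> B) \<union> (C \<inter> D)"
    using V by blast
  also have "?X \<inter> ?Y = (A \<inter> B) \<inter> (C \<inter> D)"
    by blast
  also have "card ((A \<inter> B) \<union> (C \<inter> D)) + card ((A \<inter> B) \<inter> (C \<inter> D)) = card (A \<inter> B) + card (C \<inter> D)"
    by (rule card_Un_Int[symmetric]) (use fin in auto)
  finally show ?thesis
    by (simp add: st corner_def sep_order_def)
qed

text \<open>
  If the nestedness of \<open>r\<close> with \<open>s\<close> and \<open>t\<close> does not pass on to the corner, then \<open>s\<close> and \<open>t\<close>
  are nested with each other by transitivity through \<open>r\<close>; these are cases 6 and 7, which crossing
  rules out.
\<close>

lemma nested_corner:
  assumes "crosses s t" "nested r s" "nested r t"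
  shows "nested r (corner s t)"
proof -
  obtain A B C D E F where st: "s = (A, B)" "t = (C, D)" "r = (E, F)"
    by (cases s; cases t; cases r)
  have "A \<subseteq> E \<and> F \<subseteq> B \<or> E \<subseteq> B \<and> A \<subseteq> F \<or> E \<subseteq> A \<and> B \<subseteq> F \<or> B \<subseteq> E \<and> F \<subseteq> A"
    "C \<subseteq> E \<and> F \<subseteq> D \<or> E \<subseteq> D \<and> C \<subseteq> F \<or> E \<subseteq> C \<and> D \<subseteq> F \<or> D \<subseteq> E \<and> F \<subseteq> C"
    using assms(2,3) by (auto simp: st nested_iff)
  then consider "A \<subseteq> E" "F \<subseteq> B" | "E \<subseteq> B" "A \<subseteq> F" | "C \<subseteq> E" "F \<subseteq> D" | "E \<subseteq> D" "C \<subseteq> F"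
    | "E \<subseteq> A" "B \<subseteq> F" "E \<subseteq> C" "D \<subseteq> F" | "E \<subseteq> A" "B \<subseteq> F" "D \<subseteq> E" "F \<subseteq> C"
    | "B \<subseteq> E" "F \<subseteq> A" "E \<subseteq> C" "D \<subseteq> F" | "B \<subseteq> E" "F \<subseteq> A" "D \<subseteq> E" "F \<subseteq> C"
    by argo
  then show ?thesis
  proof cases
    case 6
    then have "D \<subseteq> A" "B \<subseteq> C"
      by (meson order_trans)+
    then show ?thesis
      using assms(1) by (simp add: st nested_iff)
  next
    case 7
    then have "D \<subseteq> A" "B \<subseteq> C"
      by (meson order_trans)+
    then show ?thesis
      using assms(1) by (simp add: st nested_iff)
  qed (simp_all add: st nested_iff corner_def le_infI1 le_infI2 le_supI1 le_supI2)
qed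

lemma nested_some_opposite_corner:
  assumes "nested r s \<or> nested r t"
  shows "nested r (corner s t) \<or> nested r (corner (prod.swap s) (prod.swap t))"
proof -
  obtain A B C D E F where st: "s = (A, B)" "t = (C, D)" "r = (E, F)"
    by (cases s; cases t; cases r)
  show ?thesis
    using assms unfolding st corner_def nested_iff prod.case swap_simp
    by (elim disjE; elim conjE; simp add: le_infI1 le_infI2 le_supI1 le_supI2)
qed

lemma nested_corner_parent [simp]: "nested (corner s t) s" "nested (corner s t) t"
  by (cases s; cases t; auto simp: nested_iff corner_def)+

definition crossing_number :: "'a ugraph \<Rightarrow> 'a sep \<Rightarrow> nat" where
  "crossing_number G s = card {r. separation G r \<and> crosses r s}"

lemma crossing_number_swap [simp]: "crossing_number G (prod.swap s) = crossing_number G s"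
  by (simp add: crossing_number_def)

text \<open>
  A separation crossing one of two opposite corners crosses \<open>s\<close> or \<open>t\<close>, and one crossing both
  corners crosses both \<open>s\<close> and \<open>t\<close>. The drop is strict since \<open>s\<close> crosses \<open>t\<close> but neither corner.
\<close>

lemma crossing_number_corners:
  assumes G: "finite_graph G" and s: "separation G s" and t: "separation G t"
    and cr: "crosses s t"
  shows "crossing_number G (corner s t) + crossing_number G (corner (prod.swap s) (prod.swap t)) <
    crossing_number G s + crossing_number G t"
proof -
  define X where "X u = {r. separation G r \<and> crosses r u}" for u
  let ?c = "corner s t" and ?d = "corner (prod.swap s) (prod.swap t)"
  have fin: "finite (X u)" for u
    by (rule finite_subset[OF _ finite_separations[OF G]]) (auto simp: X_def)
  have cr': "crosses (prod.swap s) (prod.swap t)"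
    using cr by simp
  have Un: "X ?c \<union> X ?d \<subseteq> X s \<union> X t"
    using nested_corner[OF cr] nested_corner[OF cr'] by (auto simp: X_def)
  have Int: "X ?c \<inter> X ?d \<subseteq> X s \<inter> X t"
    using nested_some_opposite_corner[of _ s t] by (auto simp: X_def)
  have "s \<in> X t"
    using s cr by (simp add: X_def)
  moreover have "s \<notin> X ?c" "s \<notin> X ?d"
    using nested_corner_parent(1)[of s t] nested_corner_parent(1)[of "prod.swap s" "prod.swap t"]
    by (simp_all add: X_def nested_commute[of s])
  ultimately have "X ?c \<union> X ?d \<subset> X s \<union> X t"
    using Un by blast
  then have "card (X ?c \<union> X ?d) < card (X s \<union> X t)"
    by (intro psubset_card_mono) (simp_all add: fin)
  moreover have "card (X ?c \<inter> X ?d) \<le> card (X s \<inter> X t)"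
    using Int by (intro card_mono) (simp_all add: fin)
  moreover have "card (X ?c) + card (X ?d) = card (X ?c \<union> X ?d) + card (X ?c \<inter> X ?d)"
      "card (X s) + card (X t) = card (X s \<union> X t) + card (X s \<inter> X t)"
    by (rule card_Un_Int; rule fin)+
  ultimately show ?thesis
    unfolding crossing_number_def X_def by linarith
qed


section \<open>Robust sets and their efficient separations\<close>

text \<open>
  An \<open>l\<close>-separation \<open>(C, D)\<close> with \<open>U \<subseteq> D\<close> is enlarged to a \<open>k\<close>-separation \<open>(C \<union> X, D)\<close> with
  \<open>k - l\<close> vertices \<open>X\<close> of \<open>U - C\<close>. Each corner boundary grows by at most \<open>k - l\<close>, so stays below
  \<open>k\<close>, and robustness for \<open>k\<close> applies; if the enlarged separation no longer crosses \<open>(A, B)\<close>,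
  the new nesting already puts \<open>D\<close>, and thus \<open>U\<close>, into one side.
\<close>

lemma robust_antimono:
  assumes G: "finite_graph G" and R: "robust G K k U" and lk: "l \<le> k"
  shows "robust G K l U"
  unfolding robust_def
proof (intro conjI allI impI)
  have U: "inseparable G k U"
    using R by (simp add: robust_def)
  then show "inseparable G l U"
    using inseparable_antimono G lk by blast
  fix t s
  assume *: "separation G t \<and> sep_order t = l \<and> U \<subseteq> snd t \<and>
      separation G s \<and> sep_order s \<le> K \<and> crosses s t \<and>
      card (corner_boundary s t) < l \<and> card (corner_boundary (prod.swap s) t) < l"
  obtain A B C D where st: "s = (A, B)" "t = (C, D)"
    by (cases s; cases t)
  have fin: "finite C" "finite D" and finU: "finite U"
    using finite_sides[OF G] * U G
    by (auto simp: st inseparable_def finite_graph_def intro: finite_subset)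
  have UD: "U \<subseteq> D" and l: "card (C \<inter> D) = l"
    using * by (auto simp: st sep_order_def)
  have "card (U - C) \<ge> card U - card (C \<inter> D)"
    using UD fin finU by (intro order_trans[OF diff_card_le_card_Diff card_mono]) auto
  moreover have "k < card U"
    using U by (simp add: inseparable_def)
  ultimately have "k - l \<le> card (U - C)"
    using l by linarith
  then obtain X where X: "X \<subseteq> U - C" "card X = k - l" "finite X"
    using obtain_subset_with_card_n by metis
  have sep: "separation G (C \<union> X, D)"
    using * X UD by (auto simp: st separation_iff)
  have "(C \<union> X) \<inter> D = (C \<inter> D) \<union> X" "(C \<inter> D) \<inter> X = {}"
    using X UD by auto
  then have ord: "sep_order (C \<union> X, D) = k"
    using X fin l lk by (simp add: sep_order_def card_Un_disjoint)
  have small: "card (corner_boundary r (C \<union> X, D)) < k"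
    if "card (corner_boundary r (C, D)) < l" for r
  proof -
    have "corner_boundary r (C \<union> X, D) \<subseteq> corner_boundary r (C, D) \<union> X"
      by (cases r) (auto simp: corner_boundary_def)
    moreover have "finite (corner_boundary r (C, D))"
      using fin by (cases r) (auto simp: corner_boundary_def)
    ultimately have "card (corner_boundary r (C \<union> X, D)) \<le> card (corner_boundary r (C, D) \<union> X)"
      using X by (intro card_mono) auto
    also have "\<dots> \<le> card (corner_boundary r (C, D)) + card X"
      by (rule card_Un_le)
    finally show ?thesis
      using that X lk by linarith
  qed
  show "U \<subseteq> fst s \<or> U \<subseteq> snd s"
  proof (cases "nested s (C \<union> X, D)")
    case True
    then show ?thesis
      using * UD by (auto simp: st nested_iff)
  next
    case False
    have "card (corner_boundary s (C \<union> X, D)) < k"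
      "card (corner_boundary (prod.swap s) (C \<union> X, D)) < k"
      using small * st by auto
    moreover have "U \<subseteq> snd (C \<union> X, D)"
      using UD by simp
    ultimately show ?thesis
      using R sep ord False * unfolding robust_def by blast
  qed
qed

text \<open>
  Here \<open>l\<close> is only a lower bound on the cost of separating the pair; it is the exact cost when
  \<open>efficient_seps\<close> below is nonempty. Arbitrary robust sets take the place of blocks because being
  robust at order \<open>l\<close> is visibly invariant and does not refer to ranks.
\<close>

definition robust_pair :: "'a ugraph \<Rightarrow> nat \<Rightarrow> nat \<Rightarrow> 'a set \<Rightarrow> 'a set \<Rightarrow> bool" where
  "robust_pair G K l b1 b2 \<longleftrightarrow> robust G K l b1 \<and> robust G K l b2 \<and>
     (\<forall>s. separation G s \<and> separates s b1 b2 \<longrightarrow> l \<le> sep_order s)"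

definition efficient_seps :: "'a ugraph \<Rightarrow> nat \<Rightarrow> 'a set \<Rightarrow> 'a set \<Rightarrow> 'a sep set" where
  "efficient_seps G l b1 b2 = {s. separation G s \<and> sep_order s = l \<and> separates s b1 b2}"

lemma robust_pair_commute: "robust_pair G K l b1 b2 \<longleftrightarrow> robust_pair G K l b2 b1"
  by (auto simp: robust_pair_def separates_commute[of _ b1])

lemma efficient_seps_commute: "efficient_seps G l b1 b2 = efficient_seps G l b2 b1"
  by (auto simp: efficient_seps_def separates_commute[of _ b1])

lemma efficient_seps_swap [simp]:
  "prod.swap s \<in> efficient_seps G l b1 b2 \<longleftrightarrow> s \<in> efficient_seps G l b1 b2"
  by (simp add: efficient_seps_def)

lemma efficient_proper:
  assumes "s \<in> efficient_seps G l b1 b2"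
  shows "proper s"
  using assms by (cases s) (auto simp: efficient_seps_def separates_def proper_def)

text \<open>
  If \<open>v \<in> A \<inter> B\<close> has no neighbour in \<open>A - B\<close>, then \<open>(A - {v}, B)\<close> is still a separation. The set
  on the \<open>A\<close> side might contain \<open>v\<close>, but being \<open>l\<close>-inseparable it must lie on one side of this
  cheaper separation, and that cannot be \<open>B\<close>.
\<close>

lemma efficient_tight:
  assumes G: "finite_graph G" and b: "robust_pair G K l b1 b2" and s: "s \<in> efficient_seps G l b1 b2"
  shows "tight G s"
proof -
  have nbr: "\<exists>u\<in>A - B. adj G v u"
    if AB: "(A, B) \<in> efficient_seps G l b1 b2" and v: "v \<in> A \<inter> B" for A B v
  proof (rule ccontr)
    assume no: "\<not> ?thesis"
    have sAB: "separation G (A, B)" "card (A \<inter> B) = l" "separates (A, B) b1 b2"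
      using AB by (auto simp: efficient_seps_def sep_order_def)
    have "e \<subseteq> A - {v} \<or> e \<subseteq> B" if "e \<in> edges G" for e
    proof -
      have "e \<subseteq> B" if "v \<in> e" "e \<subseteq> A"
      proof
        fix u assume u: "u \<in> e"
        have "e = {v, u}" if "u \<noteq> v"
          using G \<open>e \<in> edges G\<close> u \<open>v \<in> e\<close> that by (auto simp: finite_graph_def card_2_iff)
        then show "u \<in> B"
          using no \<open>e \<in> edges G\<close> \<open>e \<subseteq> A\<close> u v by (auto simp: adj_def)
      qed
      then show ?thesis
        using sAB that by (auto simp: separation_iff)
    qed
    then have sep: "separation G (A - {v}, B)"
      using sAB v by (auto simp: separation_iff)
    have fin: "finite (A \<inter> B)"
      using finite_sides[OF G sAB(1)] by simp
    have less: "card ((A - {v}) \<inter> B) < l"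
      unfolding sAB(2)[symmetric] by (rule psubset_card_mono[OF fin]) (use v in auto)
    have ins: "inseparable G l b1" "inseparable G l b2"
      using b by (auto simp: robust_pair_def robust_def)
    have or: "b \<subseteq> A - {v} \<or> b \<subseteq> B" if "inseparable G l b" for b
      using inseparable_side[OF G that sep] less by auto
    have "separates (A - {v}, B) b1 b2"
      using sAB(3) or[OF ins(1)] or[OF ins(2)] by (auto simp: separates_def)
    then have "l \<le> card ((A - {v}) \<inter> B)"
      using b sep by (force simp: robust_pair_def sep_order_def)
    then show False
      using less by simp
  qed
  obtain A B where AB: "s = (A, B)"
    by (cases s)
  then have "(B, A) \<in> efficient_seps G l b1 b2"
    using s efficient_seps_swap[of "(A, B)"] by simp
  then show ?thesis
    using nbr[of A B] nbr[of B A] s AB by (auto simp: tight_def)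
qed

text \<open>
  The bound on the order matters: \<open>b1\<close> could lie inside a large separator of the corner, and only
  its inseparability, which makes it larger than a separator of order at most \<open>l\<close>, prevents that.
\<close>

lemma separates_corner:
  assumes G: "finite_graph G" and b1: "inseparable G l b1"
    and s: "separation G (A, B)" "separates (A, B) b1 b2" and t: "separation G (C, D)"
    and sub: "b1 \<subseteq> A" "b2 \<subseteq> B" "b1 \<subseteq> C"
    and ord: "sep_order (corner (A, B) (C, D)) \<le> l"
  shows "separates (corner (A, B) (C, D)) b1 b2"
proof -
  have sep: "separation G (A \<inter> C, B \<union> D)" "card ((A \<inter> C) \<inter> (B \<union> D)) \<le> l"
    using separation_corner[OF s(1) t] ord by (simp_all add: corner_def sep_order_def)
  show ?thesis
    using inseparable_not_in_separator[OF G b1 sep] s(2) sub by (auto simp: separates_def corner_def)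
qed

lemma corner_order_ge:
  assumes G: "finite_graph G" and p: "robust_pair G K l b1 b2"
    and s: "separation G (A, B)" "separates (A, B) b1 b2" and t: "separation G (C, D)"
    and sub: "b1 \<subseteq> A" "b2 \<subseteq> B" "b1 \<subseteq> C"
  shows "l \<le> sep_order (corner (A, B) (C, D))"
proof (rule ccontr)
  assume less: "\<not> ?thesis"
  have "inseparable G l b1"
    using p by (simp add: robust_pair_def robust_def)
  then have "separates (corner (A, B) (C, D)) b1 b2"
    using separates_corner[OF G _ s t sub] less by simp
  then show False
    using p less separation_corner[OF s(1) t] unfolding robust_pair_def by blast
qed

lemma corner_efficient:
  assumes G: "finite_graph G" and p: "robust_pair G K l b1 b2"
    and s: "separation G (A, B)" "separates (A, B) b1 b2" and t: "separation G (C, D)"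
    and sub: "b1 \<subseteq> A" "b2 \<subseteq> B" "b1 \<subseteq> C"
    and ord: "sep_order (corner (A, B) (C, D)) \<le> l"
  shows "corner (A, B) (C, D) \<in> efficient_seps G l b1 b2"
proof -
  have "inseparable G l b1"
    using p by (simp add: robust_pair_def robust_def)
  then show ?thesis
    using separates_corner[OF G _ s t sub ord] corner_order_ge[OF G p s t sub] ord
      separation_corner[OF s(1) t] by (simp add: efficient_seps_def)
qed

text \<open>
  Say \<open>s = (A, B)\<close> and \<open>t = (C, D)\<close>, with \<open>b3\<close> and \<open>b4\<close> on the side \<open>A\<close> and \<open>b2\<close> on the side \<open>B\<close>.
  Since \<open>l < m\<close>, the set \<open>b2\<close> is only known to be \<open>l\<close>-inseparable and need not lie on one side
  of \<open>(C, D)\<close> by inseparability alone. If both corners contained in \<open>A\<close> have order above \<open>m\<close>, then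
  both contained in \<open>B\<close> have order below \<open>l\<close>, and this is where robustness forces such a side.
\<close>

lemma corner_of_lower_order:
  assumes G: "finite_graph G"
    and p: "robust_pair G K l b1 b2" and s: "s \<in> efficient_seps G l b1 b2"
    and q: "robust_pair G K m b3 b4" and t: "t \<in> efficient_seps G m b3 b4"
    and lm: "l < m" "m \<le> K" and cr: "crosses s t"
  shows "\<exists>s' t'. s' \<in> {s, prod.swap s} \<and> t' \<in> {t, prod.swap t} \<and> corner s' t' \<in> efficient_seps G m b3 b4"
proof -
  \<comment> \<open>The case where both \<open>b3\<close> and \<open>b4\<close> lie on the side of \<open>b1\<close>; the rest is symmetric.\<close>
  have *: "corner (A, B) (C, D) \<in> efficient_seps G m b3 b4 \<or>
      corner (A, B) (D, C) \<in> efficient_seps G m b3 b4"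
    if s: "(A, B) \<in> efficient_seps G l b1 b2" and t: "(C, D) \<in> efficient_seps G m b3 b4"
      and cr: "crosses (A, B) (C, D)" and p: "robust_pair G K l b1 b2" and q: "robust_pair G K m b3 b4"
      and sub: "b1 \<subseteq> A" "b2 \<subseteq> B" "b3 \<subseteq> C" "b4 \<subseteq> D" "b3 \<subseteq> A" "b4 \<subseteq> A" for A B C D b1 b2 b3 b4
  proof (rule ccontr)
    assume no: "\<not> ?thesis"
    have AB: "separation G (A, B)" "sep_order (A, B) = l" "separates (A, B) b1 b2"
      and BA: "separation G (B, A)" "separates (B, A) b2 b1"
      and CD: "separation G (C, D)" "sep_order (C, D) = m" "separates (C, D) b3 b4"
      and DC: "separation G (D, C)" "sep_order (D, C) = m" "separates (D, C) b4 b3"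
      using s t by (auto simp: efficient_seps_def separation_iff separates_def sep_order_def Int_commute)
    have q': "robust_pair G K m b4 b3" and p': "robust_pair G K l b2 b1"
      using p q robust_pair_commute by blast+
    have "m < sep_order (corner (A, B) (C, D))" "m < sep_order (corner (A, B) (D, C))"
      using no corner_efficient[OF G q CD(1,3) AB(1) sub(3,4,5)]
        corner_efficient[OF G q' DC(1,3) AB(1) sub(4,3,6)] efficient_seps_commute[of G m b3]
        corner_commute by (metis not_le)+
    then have less: "sep_order (corner (B, A) (D, C)) < l" "sep_order (corner (B, A) (C, D)) < l"
      using sep_order_corners[OF G AB(1) CD(1)] sep_order_corners[OF G AB(1) DC(1)] AB(2) CD(2) DC(2)
      by simp_all
    then have "card (corner_boundary (C, D) (A, B)) < l"
      "card (corner_boundary (prod.swap (C, D)) (A, B)) < l"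
      by (simp_all add: corner_boundary_def corner_def sep_order_def Int_ac Un_commute)
    moreover have "robust G K l b2" "crosses (C, D) (A, B)"
      using p cr by (simp_all add: robust_pair_def nested_commute[of "(C, D)"])
    ultimately have "b2 \<subseteq> fst (C, D) \<or> b2 \<subseteq> snd (C, D)"
      using AB CD lm sub(2) unfolding robust_def
      by (metis snd_conv)
    then show False
      using corner_order_ge[OF G p' BA CD(1) sub(2,1)] corner_order_ge[OF G p' BA DC(1) sub(2,1)] less
      by auto
  qed
  obtain A B where AB: "s = (A, B) \<or> s = (B, A)" "b1 \<subseteq> A" "b2 \<subseteq> B"
    using s by (cases s) (auto simp: efficient_seps_def separates_def)
  obtain C D where CD: "t = (C, D) \<or> t = (D, C)" "b3 \<subseteq> C" "b4 \<subseteq> D"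
    using t by (cases t) (auto simp: efficient_seps_def separates_def)
  have eff: "(A, B) \<in> efficient_seps G l b1 b2" "(B, A) \<in> efficient_seps G l b2 b1"
      "(C, D) \<in> efficient_seps G m b3 b4"
    using AB(1) CD(1) s t efficient_seps_swap[of "(A, B)"] efficient_seps_swap[of "(C, D)"]
      efficient_seps_commute[of G l b1] by auto
  have crAB: "crosses (A, B) (C, D)" "crosses (B, A) (C, D)"
    using AB(1) CD(1) cr by (auto simp: nested_iff)
  have p': "robust_pair G K l b2 b1"
    using p robust_pair_commute by blast
  have sepAB: "separation G (A, B)" "card (A \<inter> B) = l"
    using eff by (auto simp: efficient_seps_def sep_order_def)
  have ins: "inseparable G m b3" "inseparable G m b4"
    using q by (auto simp: robust_pair_def robust_def)
  have side: "b3 \<subseteq> A \<or> b3 \<subseteq> B" "b4 \<subseteq> A \<or> b4 \<subseteq> B"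
    using inseparable_side[OF G _ sepAB(1)] ins sepAB(2) lm by auto
  have notin: "\<not> b3 \<subseteq> A \<inter> B" "\<not> b4 \<subseteq> A \<inter> B"
    using inseparable_not_in_separator[OF G _ sepAB(1)] ins sepAB(2) lm by auto
  have "\<not> separates (A, B) b3 b4"
    using q sepAB lm by (force simp: robust_pair_def sep_order_def)
  then consider "b3 \<subseteq> A" "b4 \<subseteq> A" | "b3 \<subseteq> B" "b4 \<subseteq> B"
    using side notin by (auto simp: separates_def)
  then have "corner (A, B) (C, D) \<in> efficient_seps G m b3 b4 \<or>
      corner (A, B) (D, C) \<in> efficient_seps G m b3 b4 \<or>
      corner (B, A) (C, D) \<in> efficient_seps G m b3 b4 \<or>
      corner (B, A) (D, C) \<in> efficient_seps G m b3 b4"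
    using *[OF eff(1,3) crAB(1) p q AB(2,3) CD(2,3)] *[OF eff(2,3) crAB(2) p' q AB(3,2) CD(2,3)]
    by cases blast+
  moreover have "(A, B) \<in> {s, prod.swap s}" "(B, A) \<in> {s, prod.swap s}"
      "(C, D) \<in> {t, prod.swap t}" "(D, C) \<in> {t, prod.swap t}"
    using AB(1) CD(1) by auto
  ultimately show ?thesis
    by blast
qed


section \<open>The nested system\<close>

definition candidates :: "'a ugraph \<Rightarrow> 'a sep set \<Rightarrow> nat \<Rightarrow> 'a set \<Rightarrow> 'a set \<Rightarrow> 'a sep set" where
  "candidates G M l b1 b2 = {s \<in> efficient_seps G l b1 b2. \<forall>r\<in>M. nested r s}"

definition best_candidates :: "'a ugraph \<Rightarrow> 'a sep set \<Rightarrow> nat \<Rightarrow> 'a set \<Rightarrow> 'a set \<Rightarrow> 'a sep set" where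
  "best_candidates G M l b1 b2 = {s \<in> candidates G M l b1 b2.
     \<forall>c\<in>candidates G M l b1 b2. crossing_number G s \<le> crossing_number G c}"

primrec nested_seps :: "'a ugraph \<Rightarrow> nat \<Rightarrow> nat \<Rightarrow> 'a sep set" where
  "nested_seps G K 0 = {}"
| "nested_seps G K (Suc l) = nested_seps G K l \<union>
     \<Union> {best_candidates G (nested_seps G K l) l b1 b2 | b1 b2. robust_pair G K l b1 b2}"

text \<open>
  The default equation for \<open>Suc\<close> unfolds membership into an existential over sets of separations;
  the form below names the witnessing pair instead.
\<close>

lemma mem_nested_seps_Suc:
  "s \<in> nested_seps G K (Suc l) \<longleftrightarrow> s \<in> nested_seps G K l \<or>
    (\<exists>b1 b2. robust_pair G K l b1 b2 \<and> s \<in> best_candidates G (nested_seps G K l) l b1 b2)"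
  by auto

declare nested_seps.simps(2) [simp del]

lemma candidates_commute: "candidates G M l b1 b2 = candidates G M l b2 b1"
  by (simp add: candidates_def efficient_seps_commute[of G l b1])

lemma best_candidates_commute: "best_candidates G M l b1 b2 = best_candidates G M l b2 b1"
  by (simp add: best_candidates_def candidates_commute[of G M l b1])

lemma best_candidates_swap:
  "prod.swap s \<in> best_candidates G M l b1 b2 \<longleftrightarrow> s \<in> best_candidates G M l b1 b2"
  by (simp add: best_candidates_def candidates_def)

lemma nested_seps_swap: "prod.swap s \<in> nested_seps G K l \<longleftrightarrow> s \<in> nested_seps G K l"
proof (induction l)
  case (Suc l)
  then show ?case
    by (simp add: mem_nested_seps_Suc best_candidates_swap)
qed simp

lemma nested_seps_efficient:
  assumes "s \<in> nested_seps G K l"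
  shows "\<exists>m b1 b2. m < l \<and> robust_pair G K m b1 b2 \<and> s \<in> efficient_seps G m b1 b2"
  using assms
proof (induction l)
  case (Suc l)
  from Suc.prems consider "s \<in> nested_seps G K l"
    | b1 b2 where "robust_pair G K l b1 b2" "s \<in> best_candidates G (nested_seps G K l) l b1 b2"
    by (auto simp: mem_nested_seps_Suc)
  then show ?case
  proof cases
    case 1
    then show ?thesis
      using Suc.IH less_Suc_eq by blast
  next
    case 2
    then show ?thesis
      unfolding best_candidates_def candidates_def by blast
  qed
qed simp

lemma nested_seps_mono: "l \<le> m \<Longrightarrow> nested_seps G K l \<subseteq> nested_seps G K m"
  by (rule lift_Suc_mono_le[of "nested_seps G K"]) (auto simp: mem_nested_seps_Suc)

text \<open>
  Take an efficient separation \<open>t\<close> crossing as few members of the earlier stages as possible. If it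
  crossed some \<open>s\<close> of them, the corner from \<open>corner_of_lower_order\<close> would be nested with \<open>s\<close> and, as
  the earlier stages are nested, with every member that \<open>t\<close> is nested with.
\<close>

lemma best_candidate_exists:
  assumes G: "finite_graph G" and M: "nested_system (nested_seps G K l)" and lK: "l \<le> K"
    and p: "robust_pair G K l b1 b2" and ne: "efficient_seps G l b1 b2 \<noteq> {}"
  shows "best_candidates G (nested_seps G K l) l b1 b2 \<noteq> {}"
proof -
  define M where "M = nested_seps G K l"
  define crossed where "crossed s = {r \<in> M. crosses r s}" for s
  have finM: "finite M"
    by (rule finite_subset[OF _ finite_separations[OF G]])
      (auto simp: M_def efficient_seps_def dest: nested_seps_efficient)
  obtain t where t: "t \<in> efficient_seps G l b1 b2"
    and min: "\<And>c. c \<in> efficient_seps G l b1 b2 \<Longrightarrow> card (crossed t) \<le> card (crossed c)"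
    using ne exists_least_iff[of "\<lambda>n. \<exists>c\<in>efficient_seps G l b1 b2. card (crossed c) = n"]
    by (metis all_not_in_conv not_le)
  have "nested s t" if s: "s \<in> M" for s
  proof (rule ccontr)
    assume cr: "crosses s t"
    obtain m b3 b4 where "m < l" "robust_pair G K m b3 b4" "s \<in> efficient_seps G m b3 b4"
      using s nested_seps_efficient unfolding M_def by blast
    then obtain s' t' where st: "s' \<in> {s, prod.swap s}" "t' \<in> {t, prod.swap t}"
      and c: "corner s' t' \<in> efficient_seps G l b1 b2"
      using corner_of_lower_order[OF G _ _ p t _ lK cr] by blast
    have cr': "crosses s' t'"
      using st cr by auto
    have nn: "nested r s' \<longleftrightarrow> nested r s" "nested r t' \<longleftrightarrow> nested r t" for r
      using st by auto
    have "nested r (corner s' t')" if "r \<in> M" "nested r t" for r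
      using nested_corner[OF cr', of r] nn that s assms(2)
      by (auto simp: M_def nested_system_def)
    moreover have "nested s (corner s' t')"
      using nested_corner_parent(1)[of s' t'] nn(1)[of "corner s' t'"] nested_commute by blast
    ultimately have "crossed (corner s' t') \<subset> crossed t"
      unfolding crossed_def using s cr by blast
    then have "card (crossed (corner s' t')) < card (crossed t)"
      by (intro psubset_card_mono) (simp_all add: crossed_def finM)
    then show False
      using min[OF c] by simp
  qed
  then have "t \<in> candidates G M l b1 b2"
    using t by (simp add: candidates_def)
  then obtain c where "c \<in> candidates G M l b1 b2"
      "\<forall>d\<in>candidates G M l b1 b2. crossing_number G c \<le> crossing_number G d"
    using exists_least_iff[of "\<lambda>n. \<exists>c\<in>candidates G M l b1 b2. crossing_number G c = n"]
    by (metis not_le)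
  then show ?thesis
    unfolding best_candidates_def M_def by blast
qed

text \<open>
  Suppose \<open>(A, B)\<close> and \<open>(C, D)\<close> cross, and call \<open>(A \<inter> C, B \<union> D)\<close> and \<open>(B \<inter> D, A \<union> C)\<close> the two
  opposite corners. If \<open>b1\<close> lives in the first and \<open>b4\<close> in the second, the corners are efficient for
  \<open>b1, b2\<close> and for \<open>b3, b4\<close> respectively, because both have order at least \<open>l\<close> and the orders add up
  to \<open>2 * l\<close>; the drop in crossing numbers is then impossible. If instead \<open>b1\<close> and \<open>b2\<close> live in
  the two corners, both are efficient for \<open>b1, b2\<close>, which only says that \<open>(A, B)\<close> has the smaller
  crossing number.
\<close>

lemma no_opposite_corners:
  assumes G: "finite_graph G"
    and p: "robust_pair G K l b1 b2" and s: "(A, B) \<in> best_candidates G M l b1 b2"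
    and q: "robust_pair G K l b3 b4" and t: "(C, D) \<in> best_candidates G M l b3 b4"
    and cr: "crosses (A, B) (C, D)"
    and sub: "b1 \<subseteq> A" "b2 \<subseteq> B" "b3 \<subseteq> C" "b4 \<subseteq> D"
  shows "\<not> (b1 \<subseteq> C \<and> b4 \<subseteq> B)"
    and "b1 \<subseteq> C \<and> b2 \<subseteq> D \<Longrightarrow> crossing_number G (A, B) < crossing_number G (C, D)"
proof -
  let ?c = "corner (A, B) (C, D)" and ?d = "corner (B, A) (D, C)"
  have AB: "separation G (A, B)" "sep_order (A, B) = l" "separates (A, B) b1 b2"
    and BA: "separation G (B, A)" "separates (B, A) b2 b1"
    and CD: "separation G (C, D)" "sep_order (C, D) = l" "separates (C, D) b3 b4"
    and DC: "separation G (D, C)" "separates (D, C) b4 b3"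
    using s t by (auto simp: best_candidates_def candidates_def efficient_seps_def separation_iff
        separates_def sep_order_def Int_commute)
  have sc: "separation G ?c" "separation G ?d"
    using separation_corner AB BA CD DC by blast+
  have ord: "sep_order ?c + sep_order ?d = l + l"
    using sep_order_corners[OF G AB(1) CD(1)] AB CD by simp
  have crn: "crossing_number G ?c + crossing_number G ?d <
      crossing_number G (A, B) + crossing_number G (C, D)"
    using crossing_number_corners[OF G AB(1) CD(1) cr] by simp
  have nAB: "nested r (A, B)" "nested r (B, A)" and nCD: "nested r (C, D)" "nested r (D, C)"
    if "r \<in> M" for r
    using s t that nested_swap2[of r "(A, B)"] nested_swap2[of r "(C, D)"]
    by (auto simp: best_candidates_def candidates_def)
  have "crosses (B, A) (D, C)"
    using cr by (auto simp: nested_iff)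
  then have nest: "nested r ?c" "nested r ?d" if "r \<in> M" for r
    using nested_corner cr nAB nCD that by blast+
  have best: "crossing_number G (A, B) \<le> crossing_number G x"
    if "x \<in> efficient_seps G l b1 b2" "\<And>r. r \<in> M \<Longrightarrow> nested r x" for x
    using s that unfolding best_candidates_def candidates_def by blast
  have best': "crossing_number G (C, D) \<le> crossing_number G x"
    if "x \<in> efficient_seps G l b3 b4" "\<And>r. r \<in> M \<Longrightarrow> nested r x" for x
    using t that unfolding best_candidates_def candidates_def by blast
  have p': "robust_pair G K l b2 b1" and q': "robust_pair G K l b4 b3"
    using p q robust_pair_commute by blast+
  show "\<not> (b1 \<subseteq> C \<and> b4 \<subseteq> B)"
  proof
    assume *: "b1 \<subseteq> C \<and> b4 \<subseteq> B"
    have ge: "l \<le> sep_order ?c" "l \<le> sep_order ?d"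
      using corner_order_ge[OF G p AB(1,3) CD(1) sub(1,2)]
        corner_order_ge[OF G q' DC BA(1) sub(4,3)] * corner_commute[of "(D, C)"] by simp_all
    have "?c \<in> efficient_seps G l b1 b2"
      using corner_efficient[OF G p AB(1,3) CD(1) sub(1,2)] * ge ord by simp
    moreover have "?d \<in> efficient_seps G l b3 b4"
      using corner_efficient[OF G q' DC BA(1) sub(4,3)] * ge ord corner_commute[of "(D, C)"]
        efficient_seps_commute[of G l b3] by simp
    ultimately show False
      using best[OF _ nest(1)] best'[OF _ nest(2)] crn by simp
  qed
  show "crossing_number G (A, B) < crossing_number G (C, D)" if *: "b1 \<subseteq> C \<and> b2 \<subseteq> D"
  proof -
    have ge: "l \<le> sep_order ?c" "l \<le> sep_order ?d"
      using corner_order_ge[OF G p AB(1,3) CD(1) sub(1,2)]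
        corner_order_ge[OF G p' BA DC(1) sub(2,1)] * by simp_all
    have "?c \<in> efficient_seps G l b1 b2"
      using corner_efficient[OF G p AB(1,3) CD(1) sub(1,2)] * ge ord by simp
    moreover have "?d \<in> efficient_seps G l b1 b2"
      using corner_efficient[OF G p' BA DC(1) sub(2,1)] * ge ord efficient_seps_commute[of G l b1]
      by simp
    ultimately show ?thesis
      using best[OF _ nest(1)] best[OF _ nest(2)] crn by simp
  qed
qed

text \<open>
  Excluding opposite corners for all four choices of one set from each pair leaves only two
  configurations, mirror images of each other: \<open>b1, b2\<close> occupy one pair of opposite corners and
  \<open>b3, b4\<close> the other. There each of the two separations would have a smaller crossing number than
  the other.
\<close>

lemma best_candidates_nested:
  assumes G: "finite_graph G"
    and p: "robust_pair G K l b1 b2" and s: "s \<in> best_candidates G M l b1 b2"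
    and q: "robust_pair G K l b3 b4" and t: "t \<in> best_candidates G M l b3 b4"
  shows "nested s t"
proof (rule ccontr)
  assume cr: "crosses s t"
  have "separates s b1 b2" "separates t b3 b4"
    using s t by (auto simp: best_candidates_def candidates_def efficient_seps_def)
  then obtain A B C D where AB: "s = (A, B) \<or> s = (B, A)" and CD: "t = (C, D) \<or> t = (D, C)"
    and sub: "b1 \<subseteq> A" "b2 \<subseteq> B" "b3 \<subseteq> C" "b4 \<subseteq> D"
    by (cases s; cases t) (auto simp: separates_def)
  have p': "robust_pair G K l b2 b1" and q': "robust_pair G K l b4 b3"
    using p q robust_pair_commute by blast+
  have bAB: "(A, B) \<in> best_candidates G M l b1 b2" and bCD: "(C, D) \<in> best_candidates G M l b3 b4"
    using s t AB CD best_candidates_swap[of s] best_candidates_swap[of t] by auto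
  have bBA: "(B, A) \<in> best_candidates G M l b2 b1" and bDC: "(D, C) \<in> best_candidates G M l b4 b3"
    using bAB bCD best_candidates_swap[of "(A, B)"] best_candidates_swap[of "(C, D)"]
      best_candidates_commute[of G M l b1] best_candidates_commute[of G M l b3] by auto
  have cr: "crosses (A, B) (C, D)" "crosses (A, B) (D, C)" "crosses (B, A) (C, D)"
      "crosses (B, A) (D, C)" "crosses (C, D) (A, B)" "crosses (D, C) (A, B)"
    using cr AB CD by (auto simp: nested_iff)
  have orders: "separation G (A, B)" "card (A \<inter> B) \<le> l" "separation G (C, D)" "card (C \<inter> D) \<le> l"
    using bAB bCD by (auto simp: best_candidates_def candidates_def efficient_seps_def sep_order_def)
  have ins: "inseparable G l b1" "inseparable G l b2" "inseparable G l b3" "inseparable G l b4"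
    using p q by (auto simp: robust_pair_def robust_def)
  have side: "b1 \<subseteq> C \<or> b1 \<subseteq> D" "b2 \<subseteq> C \<or> b2 \<subseteq> D" "b3 \<subseteq> A \<or> b3 \<subseteq> B" "b4 \<subseteq> A \<or> b4 \<subseteq> B"
    using inseparable_side[OF G _ orders(1,2)] inseparable_side[OF G _ orders(3,4)] ins by auto
  have swp: "crossing_number G (D, C) = crossing_number G (C, D)"
    using crossing_number_swap[of G "(C, D)"] by simp
  note no1 = no_opposite_corners[OF G p bAB q bCD cr(1) sub]
  note no2 = no_opposite_corners[OF G p bAB q' bDC cr(2) sub(1,2,4,3)]
  note no3 = no_opposite_corners[OF G p' bBA q bCD cr(3) sub(2,1,3,4)]
  note no4 = no_opposite_corners[OF G p' bBA q' bDC cr(4) sub(2,1,4,3)]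
  note no5 = no_opposite_corners[OF G q bCD p bAB cr(5) sub(3,4,1,2)]
  note no6 = no_opposite_corners[OF G q' bDC p bAB cr(6) sub(4,3,1,2)]
  show False
  proof (cases "b1 \<subseteq> C")
    case True
    then have "b4 \<subseteq> A" "b2 \<subseteq> D" "b3 \<subseteq> B"
      using no1(1) no3(1) no4(1) side by blast+
    then show False
      using no1(2) no6(2) True swp by simp
  next
    case False
    then have "b1 \<subseteq> D" "b3 \<subseteq> A" "b2 \<subseteq> C" "b4 \<subseteq> B"
      using no2(1) no3(1) no4(1) side by blast+
    then show False
      using no2(2) no5(2) swp by simp
  qed
qed

lemma nested_system_nested_seps:
  assumes G: "finite_graph G"
  shows "nested_system (nested_seps G K l)"
proof (induction l)
  case (Suc l)
  let ?M = "nested_seps G K l"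
  have new: "nested s t" if t: "t \<in> nested_seps G K (Suc l)"
      and s: "robust_pair G K l b1 b2" "s \<in> best_candidates G ?M l b1 b2" for s t b1 b2
  proof (cases "t \<in> ?M")
    case True
    then show ?thesis
      using s nested_commute[of s t] by (auto simp: best_candidates_def candidates_def)
  next
    case False
    then obtain b3 b4 where "robust_pair G K l b3 b4" "t \<in> best_candidates G ?M l b3 b4"
      using t by (auto simp: mem_nested_seps_Suc)
    then show ?thesis
      using best_candidates_nested[OF G] s by blast
  qed
  show ?case
    unfolding nested_system_def
  proof (intro ballI)
    fix s t assume s: "s \<in> nested_seps G K (Suc l)" and t: "t \<in> nested_seps G K (Suc l)"
    show "nested s t"
    proof (cases "s \<in> ?M \<and> t \<in> ?M")
      case True
      then show ?thesis
        using Suc by (simp add: nested_system_def)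
    next
      case False
      then show ?thesis
        using new[OF s] new[OF t] s t nested_commute[of s t] unfolding mem_nested_seps_Suc by blast
    qed
  qed
qed (simp add: nested_system_def)


section \<open>Invariance under automorphisms\<close>

text \<open>
  An automorphism is arbitrary off the vertex set. Extending it by the identity there yields a
  bijection of the whole type, for which taking images commutes with all set operations.
\<close>

definition symmetry :: "'a ugraph \<Rightarrow> ('a \<Rightarrow> 'a) \<Rightarrow> bool" where
  "symmetry G h \<longleftrightarrow> bij h \<and> h ` verts G = verts G \<and> (\<forall>e. h ` e \<in> edges G \<longleftrightarrow> e \<in> edges G)"

abbreviation sep_image :: "('a \<Rightarrow> 'a) \<Rightarrow> 'a sep \<Rightarrow> 'a sep" where
  "sep_image h \<equiv> map_prod ((`) h) ((`) h)"

lemma symmetry_of_automorphism: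
  assumes G: "finite_graph G" and f: "automorphism G f"
  obtains h where "symmetry G h" "\<And>x. x \<in> verts G \<Longrightarrow> h x = f x"
proof
  define h where "h x = (if x \<in> verts G then f x else x)" for x
  have bf: "bij_betw f (verts G) (verts G)"
    using f by (simp add: automorphism_def)
  show eq: "h x = f x" if "x \<in> verts G" for x
    using that by (simp add: h_def)
  have b1: "bij_betw h (verts G) (verts G)"
    using bf eq by (metis bij_betw_cong)
  have b2: "bij_betw h (- verts G) (- verts G)"
    by (auto simp: bij_betw_def inj_on_def h_def image_iff)
  have bij: "bij h"
    using bij_betw_combine[OF b1 b2] by simp
  have hV: "h ` verts G = verts G"
    using b1 by (simp add: bij_betw_def)
  have "h ` e \<in> edges G \<longleftrightarrow> e \<in> edges G" for e
  proof -
    have *: "h ` {x, y} \<in> edges G \<longleftrightarrow> {x, y} \<in> edges G" if "x \<in> verts G" "y \<in> verts G" for x y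
      using f eq that by (simp add: automorphism_def adj_def)
    have sub: "e \<subseteq> verts G \<and> card e = 2" if "h ` e \<in> edges G \<or> e \<in> edges G"
    proof (cases "e \<in> edges G")
      case False
      then have "h ` e \<subseteq> h ` verts G \<and> card (h ` e) = 2"
        using G that hV by (auto simp: finite_graph_def)
      then show ?thesis
        using bij by (simp add: bij_def inj_image_subset_iff card_image inj_on_subset[of h UNIV])
    qed (use G in \<open>auto simp: finite_graph_def\<close>)
    show ?thesis
    proof (cases "e \<subseteq> verts G \<and> card e = 2")
      case True
      then obtain x y where "e = {x, y}" "x \<in> verts G" "y \<in> verts G"
        by (auto simp: card_2_iff)
      then show ?thesis
        using * by blast
    qed (use sub in blast)
  qed
  then show "symmetry G h"
    using bij hV by (simp add: symmetry_def)
qed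

lemma symmetry_inv:
  assumes "symmetry G h"
  shows "symmetry G (inv h)"
  unfolding symmetry_def
proof (intro conjI allI)
  have bij: "bij h" and V: "h ` verts G = verts G" and E: "\<And>e. h ` e \<in> edges G \<longleftrightarrow> e \<in> edges G"
    using assms by (auto simp: symmetry_def)
  show "bij (inv h)"
    using bij by (rule bij_imp_bij_inv)
  show "inv h ` verts G = verts G"
    using V bij by (metis bij_is_inj image_inv_f_f)
  show "inv h ` e \<in> edges G \<longleftrightarrow> e \<in> edges G" for e
    using E[of "inv h ` e"] bij by (simp add: image_f_inv_f bij_is_surj)
qed

context
  fixes G :: "'a ugraph" and h :: "'a \<Rightarrow> 'a"
  assumes G: "finite_graph G" and h: "symmetry G h"
begin

lemma bij_h: "bij h" and inj_h: "inj h" and surj_h: "surj h"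
  using h by (auto simp: symmetry_def bij_def)

lemma card_h: "card (h ` X) = card X"
  using inj_h by (simp add: card_image inj_on_subset[of h UNIV])

lemma surj_image_h: "surj ((`) h)"
  using surj_h by (metis surjI image_f_inv_f)

lemma surj_sep_image: "surj (sep_image h)"
  using map_prod_surj[OF surj_image_h surj_image_h] .

lemma inj_sep_image: "inj (sep_image h)"
  using inj_h by (intro prod.inj_map) (simp_all add: inj_on_def inj_image_eq_iff)

lemma separation_sep_image: "separation G (sep_image h s) \<longleftrightarrow> separation G s"
proof -
  obtain A B where s: "s = (A, B)"
    by (cases s)
  have V: "h ` verts G = verts G" and E: "\<And>e. h ` e \<in> edges G \<longleftrightarrow> e \<in> edges G"
    using h by (auto simp: symmetry_def)
  have "h ` A \<union> h ` B = verts G \<longleftrightarrow> A \<union> B = verts G"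
    using V inj_h by (metis image_Un inj_image_eq_iff)
  moreover have "(\<forall>e\<in>edges G. e \<subseteq> h ` A \<or> e \<subseteq> h ` B) \<longleftrightarrow> (\<forall>e\<in>edges G. e \<subseteq> A \<or> e \<subseteq> B)"
  proof -
    have "(\<forall>e. P e) \<longleftrightarrow> (\<forall>e. P (h ` e))" for P
      using surj_image_h by (metis surj_def)
    from this[of "\<lambda>e. e \<in> edges G \<longrightarrow> e \<subseteq> h ` A \<or> e \<subseteq> h ` B"] show ?thesis
      using inj_h by (auto simp: Ball_def E inj_image_subset_iff)
  qed
  ultimately show ?thesis
    by (simp add: s separation_iff)
qed

lemma sep_order_sep_image: "sep_order (sep_image h s) = sep_order s"
  by (cases s) (simp add: sep_order_def card_h flip: image_Int[OF inj_h])

lemma separates_sep_image: "separates (sep_image h s) (h ` I) (h ` J) \<longleftrightarrow> separates s I J"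
  by (cases s) (simp add: separates_def inj_image_subset_iff[OF inj_h] flip: image_Int[OF inj_h])

lemma nested_sep_image: "nested (sep_image h s) (sep_image h t) \<longleftrightarrow> nested s t"
  by (cases s; cases t) (simp add: nested_iff inj_image_subset_iff[OF inj_h])

lemma corner_boundary_sep_image:
  "corner_boundary (sep_image h s) (sep_image h t) = h ` corner_boundary s t"
  by (cases s; cases t) (simp add: corner_boundary_def image_Int[OF inj_h] image_Un)

lemma all_sep_image: "(\<forall>s. P s) \<longleftrightarrow> (\<forall>s. P (sep_image h s))"
  using surj_sep_image by (metis surj_def)

lemma inseparable_image: "inseparable G k (h ` X) \<longleftrightarrow> inseparable G k X"
proof -
  have "h ` X \<subseteq> verts G \<longleftrightarrow> X \<subseteq> verts G"
    using h inj_image_subset_iff[OF inj_h, of X "verts G"] by (simp add: symmetry_def)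
  then show ?thesis
    unfolding inseparable_iff[OF G]
    by (subst all_sep_image)
      (simp add: separation_sep_image sep_order_sep_image card_h inj_image_subset_iff[OF inj_h])
qed

lemma robust_image: "robust G K k (h ` U) \<longleftrightarrow> robust G K k U"
proof -
  have sw: "prod.swap (sep_image h s) = sep_image h (prod.swap s)" for s
    by (cases s) simp
  have all2: "(\<forall>t s. P t s) \<longleftrightarrow> (\<forall>t s. P (sep_image h t) (sep_image h s))" for P
    by (simp only: all_sep_image[of "\<lambda>t. \<forall>s. P t s"] all_sep_image[of "P (sep_image h t)" for t])
  show ?thesis
    unfolding robust_def
    by (subst all2)
      (simp add: separation_sep_image sep_order_sep_image inseparable_image sw corner_boundary_sep_image
        card_h nested_sep_image inj_image_subset_iff[OF inj_h] del: split_paired_All)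
qed

lemma robust_pair_image: "robust_pair G K l (h ` b1) (h ` b2) \<longleftrightarrow> robust_pair G K l b1 b2"
  unfolding robust_pair_def
  by (subst all_sep_image[of "\<lambda>s. separation G s \<and> separates s (h ` b1) (h ` b2) \<longrightarrow> l \<le> sep_order s"])
    (simp add: separation_sep_image sep_order_sep_image separates_sep_image robust_image)

lemma crossing_number_sep_image: "crossing_number G (sep_image h s) = crossing_number G s"
proof -
  have "{r. separation G r \<and> crosses r (sep_image h s)} =
      sep_image h ` {r. separation G r \<and> crosses r s}" (is "?L = ?R")
  proof (intro set_eqI)
    fix r
    obtain r' where r': "r = sep_image h r'"
      using surj_sep_image by (metis surj_def)
    show "r \<in> ?L \<longleftrightarrow> r \<in> ?R"
      unfolding r' inj_image_mem_iff[OF inj_sep_image]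
      by (simp add: separation_sep_image nested_sep_image)
  qed
  then show ?thesis
    by (simp add: crossing_number_def card_image inj_on_subset[OF inj_sep_image])
qed

lemma best_candidates_sep_image:
  assumes M: "\<And>r. sep_image h r \<in> M \<longleftrightarrow> r \<in> M"
  shows "sep_image h s \<in> best_candidates G M l (h ` b1) (h ` b2) \<longleftrightarrow> s \<in> best_candidates G M l b1 b2"
proof -
  have ball: "(\<forall>r\<in>X. P r) \<longleftrightarrow> (\<forall>r\<in>Y. P (sep_image h r))"
    if "\<And>r. sep_image h r \<in> X \<longleftrightarrow> r \<in> Y" for X Y P
    using all_sep_image[of "\<lambda>r. r \<in> X \<longrightarrow> P r"] that by (simp only: Ball_def)
  have cand: "sep_image h s \<in> candidates G M l (h ` b1) (h ` b2) \<longleftrightarrow> s \<in> candidates G M l b1 b2" for s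
  proof -
    have "(\<forall>r\<in>M. nested r (sep_image h s)) \<longleftrightarrow> (\<forall>r\<in>M. nested r s)"
      using ball[OF M, of "\<lambda>r. nested r (sep_image h s)"] unfolding nested_sep_image .
    then show ?thesis
      by (simp add: candidates_def efficient_seps_def separation_sep_image sep_order_sep_image
          separates_sep_image)
  qed
  have "(\<forall>c\<in>candidates G M l (h ` b1) (h ` b2). crossing_number G s \<le> crossing_number G c) \<longleftrightarrow>
      (\<forall>c\<in>candidates G M l b1 b2. crossing_number G s \<le> crossing_number G c)"
    using ball[OF cand, of "\<lambda>c. crossing_number G s \<le> crossing_number G c"]
    unfolding crossing_number_sep_image .
  then show ?thesis
    unfolding best_candidates_def mem_Collect_eq cand crossing_number_sep_image by simp
qed

lemma nested_seps_sep_image: "sep_image h s \<in> nested_seps G K l \<longleftrightarrow> s \<in> nested_seps G K l"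
proof (induction l arbitrary: s)
  case (Suc l)
  let ?M = "nested_seps G K l"
  have image: "robust_pair G K l (h ` b1) (h ` b2) \<and>
      sep_image h s \<in> best_candidates G ?M l (h ` b1) (h ` b2) \<longleftrightarrow>
      robust_pair G K l b1 b2 \<and> s \<in> best_candidates G ?M l b1 b2" for b1 b2
    unfolding robust_pair_image best_candidates_sep_image[OF Suc] ..
  have preimage: "\<exists>b. c = h ` b" for c
    using surj_image_h by (simp add: surj_def)
  have "(\<exists>c1 c2. robust_pair G K l c1 c2 \<and> sep_image h s \<in> best_candidates G ?M l c1 c2) \<longleftrightarrow>
      (\<exists>b1 b2. robust_pair G K l b1 b2 \<and> s \<in> best_candidates G ?M l b1 b2)" (is "?L \<longleftrightarrow> ?R")
  proof
    assume ?L
    then obtain c1 c2 where c: "robust_pair G K l c1 c2"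
      "sep_image h s \<in> best_candidates G ?M l c1 c2"
      by blast
    obtain b1 b2 where "c1 = h ` b1" "c2 = h ` b2"
      using preimage[of c1] preimage[of c2] by blast
    then have "robust_pair G K l b1 b2 \<and> s \<in> best_candidates G ?M l b1 b2"
      using c image[of b1 b2] by simp
    then show ?R
      by blast
  next
    assume ?R
    then obtain b1 b2 where "robust_pair G K l b1 b2 \<and> s \<in> best_candidates G ?M l b1 b2"
      by blast
    then have "robust_pair G K l (h ` b1) (h ` b2) \<and>
        sep_image h s \<in> best_candidates G ?M l (h ` b1) (h ` b2)"
      unfolding image .
    then show ?L
      by blast
  qed
  then show ?case
    unfolding mem_nested_seps_Suc Suc by simp
qed simp

end

lemma aut_invariant_nested_seps:
  assumes G: "finite_graph G"
  shows "aut_invariant G (nested_seps G K l)"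
  unfolding aut_invariant_def
proof (intro allI impI)
  fix f assume "automorphism G f"
  then obtain h where h: "symmetry G h" and hf: "\<And>x. x \<in> verts G \<Longrightarrow> h x = f x"
    using symmetry_of_automorphism[OF G] by metis
  let ?N = "nested_seps G K l"
  have "(case s of (A, B) \<Rightarrow> (f ` A, f ` B)) = sep_image h s" if "s \<in> ?N" for s
  proof -
    obtain A B where s: "s = (A, B)"
      by (cases s)
    then have "A \<subseteq> verts G" "B \<subseteq> verts G"
      using nested_seps_efficient[OF that] by (auto simp: efficient_seps_def separation_iff)
    then have "f ` A = h ` A" "f ` B = h ` B"
      using hf by (auto intro!: image_cong)
    then show ?thesis
      by (simp add: s)
  qed
  then have "(\<lambda>(A, B). (f ` A, f ` B)) ` ?N = sep_image h ` ?N"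
    by (rule image_cong[OF refl])
  also have "\<dots> = ?N"
  proof (intro equalityI subsetI)
    fix s assume s: "s \<in> ?N"
    obtain s' where s': "s = sep_image h s'"
      using surj_sep_image[OF G h] unfolding surj_def by blast
    then have "s' \<in> ?N"
      using s nested_seps_sep_image[OF G h] by simp
    then show "s \<in> sep_image h ` ?N"
      unfolding s' by (rule imageI)
  next
    fix s assume "s \<in> sep_image h ` ?N"
    then obtain s' where "s' \<in> ?N" "s = sep_image h s'"
      by (rule imageE)
    then show "s \<in> ?N"
      using nested_seps_sep_image[OF G h] by simp
  qed
  finally show "(\<lambda>(A, B). (f ` A, f ` B)) ` ?N = ?N" .
qed


section \<open>Blocks\<close>

lemma kblock_rank:
  assumes "block G b"
  shows "kblock G (rank G b) b"
  using assms unfolding block_def rank_def by (auto intro: LeastI)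

text \<open>
  Both sets are \<open>k\<close>-inseparable, but by maximality of \<open>b1\<close> their union is not; a separation
  witnessing this must have \<open>b1\<close> and \<open>b2\<close> on different sides.
\<close>

lemma blocks_separated:
  assumes G: "finite_graph G" and k: "k \<le> m" and b1: "kblock G k b1" and b2: "inseparable G m b2"
    and sub: "\<not> b2 \<subseteq> b1"
  obtains s where "separation G s" "separates s b1 b2" "sep_order s \<le> k"
proof -
  have i: "inseparable G k b1" "inseparable G k b2"
    using b1 b2 inseparable_antimono[OF G _ k] by (auto simp: kblock_def)
  have "\<not> inseparable G k (b1 \<union> b2)"
    using b1 sub by (auto simp: kblock_def)
  moreover have "finite (b1 \<union> b2)"
    using i G by (auto simp: inseparable_def finite_graph_def intro: finite_subset)
  then have "card (b1 \<union> b2) > k"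
    using i(1) card_mono[of "b1 \<union> b2" b1] by (auto simp: inseparable_def)
  ultimately obtain A B where s: "separation G (A, B)" "sep_order (A, B) \<le> k"
    and no: "\<not> b1 \<union> b2 \<subseteq> A" "\<not> b1 \<union> b2 \<subseteq> B"
    using i unfolding inseparable_iff[OF G] by auto
  have c: "card (A \<inter> B) \<le> k"
    using s by (simp add: sep_order_def)
  have "separates (A, B) b1 b2"
    using inseparable_side[OF G i(1) s(1) c] inseparable_side[OF G i(2) s(1) c]
      inseparable_not_in_separator[OF G i(1) s(1) c] inseparable_not_in_separator[OF G i(2) s(1) c] no
    by (auto simp: separates_def)
  then show ?thesis
    using that s by blast
qed

lemma kappa_attained:
  assumes "separation G s" "separates s b1 b2"
  shows "kappa G b1 b2 \<le> sep_order s"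
    and "\<exists>t. separation G t \<and> separates t b1 b2 \<and> sep_order t = kappa G b1 b2"
proof -
  let ?P = "\<lambda>n. \<exists>s. separation G s \<and> separates s b1 b2 \<and> sep_order s = n"
  have P: "?P (sep_order s)"
    using assms by blast
  show "kappa G b1 b2 \<le> sep_order s"
    unfolding kappa_def by (rule Least_le[of ?P, OF P])
  show "?P (kappa G b1 b2)"
    unfolding kappa_def by (rule LeastI[of ?P, OF P])
qed

lemma kappa_blocks:
  assumes G: "finite_graph G" and b: "block G b1" "block G b2" "distinguishable b1 b2"
  shows "kappa G b1 b2 \<le> rank G b1" "kappa G b1 b2 \<le> rank G b2"
    and "efficient_seps G (kappa G b1 b2) b1 b2 \<noteq> {}"
proof -
  have r: "kblock G (rank G b1) b1" "kblock G (rank G b2) b2"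
    using b kblock_rank by blast+
  then have i: "inseparable G (rank G b1) b1" "inseparable G (rank G b2) b2"
    by (auto simp: kblock_def)
  have d: "\<not> b1 \<subseteq> b2" "\<not> b2 \<subseteq> b1"
    using b by (auto simp: distinguishable_def)
  obtain s where s: "separation G s" "separates s b1 b2"
    "sep_order s \<le> rank G b1" "sep_order s \<le> rank G b2"
  proof (cases "rank G b1 \<le> rank G b2")
    case True
    then show ?thesis
      using blocks_separated[OF G True r(1) i(2) d(2)] that by (metis order_trans)
  next
    case False
    then have le: "rank G b2 \<le> rank G b1"
      by simp
    then show ?thesis
      using blocks_separated[OF G le r(2) i(1) d(1)] that separates_commute by (metis order_trans)
  qed
  show "kappa G b1 b2 \<le> rank G b1" "kappa G b1 b2 \<le> rank G b2"
    using kappa_attained(1)[OF s(1,2)] s(3,4) by simp_all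
  show "efficient_seps G (kappa G b1 b2) b1 b2 \<noteq> {}"
    using kappa_attained(2)[OF s(1,2)] by (auto simp: efficient_seps_def)
qed

lemma nested_seps_distinguish:
  assumes G: "finite_graph G" and b: "robust_block G K b1" "robust_block G K b2"
    and kd: "k_distinguishable G K b1 b2"
  shows "distinguishes_efficiently G (nested_seps G K (Suc K)) b1 b2"
proof -
  let ?l = "kappa G b1 b2"
  have lK: "?l \<le> K" and d: "distinguishable b1 b2"
    using kd by (auto simp: k_distinguishable_def)
  have bl: "block G b1" "block G b2"
    using b by (auto simp: robust_block_def)
  note kb = kappa_blocks[OF G bl d]
  have "robust G K ?l b1" "robust G K ?l b2"
    using b robust_antimono[OF G] kb(1,2) by (auto simp: robust_block_def)
  then have p: "robust_pair G K ?l b1 b2"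
    using kappa_attained(1) by (auto simp: robust_pair_def)
  obtain s where s: "s \<in> best_candidates G (nested_seps G K ?l) ?l b1 b2"
    using best_candidate_exists[OF G nested_system_nested_seps[OF G] lK p kb(3)] by blast
  have "s \<in> nested_seps G K (Suc ?l)"
    using s p mem_nested_seps_Suc by blast
  then have "s \<in> nested_seps G K (Suc K)"
    using nested_seps_mono[of "Suc ?l" "Suc K" G K] lK by blast
  then show ?thesis
    using s by (auto simp: distinguishes_efficiently_def best_candidates_def candidates_def
        efficient_seps_def)
qed

lemma rank_le:
  assumes "kblock G k b"
  shows "rank G b \<le> k"
  using assms unfolding rank_def by (rule Least_le)

text \<open>
  A \<open>k\<close>-block is \<open>k\<close>-inseparable, so any separation of order at most \<open>k\<close> has it on one side and
  robustness holds trivially, whatever its rank.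
\<close>

lemma kblock_robust:
  assumes G: "finite_graph G" and b: "kblock G k b"
  shows "robust_block G k b"
proof -
  have bl: "block G b"
    using b by (auto simp: block_def)
  have "inseparable G (rank G b) b" "inseparable G k b"
    using kblock_rank[OF bl] b by (auto simp: kblock_def)
  then show ?thesis
    using bl by (auto simp: robust_block_def robust_def inseparable_iff[OF G])
qed

lemma kblocks_distinguishable:
  assumes G: "finite_graph G" and b: "kblock G k b1" "kblock G k b2" "b1 \<noteq> b2"
  shows "k_distinguishable G k b1 b2"
proof -
  have d: "distinguishable b1 b2"
    using b by (auto simp: distinguishable_def kblock_def)
  have "block G b1" "block G b2"
    using b by (auto simp: block_def)
  then show ?thesis
    using kappa_blocks(1)[OF G _ _ d] rank_le[OF b(1)] d by (auto simp: k_distinguishable_def)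
qed

theorem theorem6p3:
  fixes G :: "'a ugraph" and k :: nat
  assumes "finite_graph G"
  shows "\<exists>N :: 'a sep set.
    separation_system G N \<and> tight_system G N \<and> nested_system N \<and> aut_invariant G N \<and>
    (\<forall>b1 b2. robust_block G k b1 \<and> robust_block G k b2 \<and> k_distinguishable G k b1 b2 \<longrightarrow>
      distinguishes_efficiently G N b1 b2) \<and>
    (\<forall>b1 b2. kblock G k b1 \<and> kblock G k b2 \<and> b1 \<noteq> b2 \<longrightarrow>
      distinguishes_efficiently G N b1 b2)"
proof -
  note G = assms
  let ?N = "nested_seps G k (Suc k)"
  have "separation G s \<and> proper s \<and> tight G s" if s: "s \<in> ?N" for s
  proof -
    obtain m b1 b2 where p: "robust_pair G k m b1 b2" and eff: "s \<in> efficient_seps G m b1 b2"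
      using nested_seps_efficient[OF s] by blast
    then show ?thesis
      using efficient_proper[OF eff] efficient_tight[OF G p eff] by (simp add: efficient_seps_def)
  qed
  then have "separation_system G ?N" "tight_system G ?N"
    using nested_seps_swap[of _ G k "Suc k"] by (auto simp: separation_system_def tight_system_def)
  moreover have "distinguishes_efficiently G ?N b1 b2"
    if "kblock G k b1" "kblock G k b2" "b1 \<noteq> b2" for b1 b2
    using nested_seps_distinguish[OF G] kblock_robust[OF G] kblocks_distinguishable[OF G] that by blast
  ultimately show ?thesis
    using nested_system_nested_seps[OF G] aut_invariant_nested_seps[OF G] nested_seps_distinguish[OF G]
    by blast
qed

end
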